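(* Let $n \ge 3$ be odd and let $P$ be a tangential polygon in the Euclidean plane with vertices $V_1, V_2, \ldots, V_n$ in cyclic order. Let $\lambda_i = V_iV_{i+1}$ for $i=1,\ldots,n-1$ and $\lambda_n = V_nV_1$ be the side lengths. For each $i$ let $t_i$ be the length of the tangent segments from $V_i$ to the incircle of $P$, and let $x_1,\ldots,x_n$ be real numbers with $x_i \ge -t_i$. Suppose that for each $i$ the two sides ending at $V_i$ are each extended beyond $V_i$ by the signed length $x_i$. Then the $2n$ endpoints of these extensions lie on a common circle centered at the incenter of $P$ if and only if $$x_i - x_{\mu(i+2,n)} = \lambda_{\mu(i+1,n)} - \lambda_i \quad\text{for all } 0 < i \le n,$$ where $\mu(z,m)$ is defined as $z \bmod m$ for $z \ne m$, and $\mu(m,m)=m$.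
   Context: A tangential polygon is a convex polygon for which there is a circle (the incircle) tangent to all of its sides; the center of this circle is the incenter. For distinct points $U, V$ and a real number $x$, the endpoint of the extension of side $UV$ beyond $V$ by the signed length $x$ is the point $V + x\,\frac{V-U}{|V-U|}$; negative $x$ means moving from $V$ back towards $U$. Endpoints are allowed to coincide. The length $t_i$ is the distance from $V_i$ to the points at which the incircle touches the two sides ending at $V_i$. *)

theory Defs
  imports "HOL-Analysis.Analysis"
begin

definition mu :: "nat \<Rightarrow> nat \<Rightarrow> nat" where
  "mu z m = (if z = m then m else z mod m)"

text \<open>Vertices are indexed by 1, ..., n. For i in this range, \<open>mu (i + 1) n\<close> and
  \<open>mu (i + n - 1) n\<close> are the cyclic successor and predecessor of i.\<close>

text \<open>P is the (filled, non-degenerate) polygon. Its vertices are its extreme points, so angles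
  are different from the straight angle; that the n segments between cyclic neighbours are
  edges of P says that V enumerates the vertices in cyclic order.\<close>

definition convex_polygon :: "(real^2) set \<Rightarrow> nat \<Rightarrow> (nat \<Rightarrow> real^2) \<Rightarrow> bool" where
  "convex_polygon P n V \<longleftrightarrow>
     polytope P \<and> aff_dim P = 2 \<and>
     bij_betw V {1..n} {v. v extreme_point_of P} \<and>
     (\<forall>i\<in>{1..n}. closed_segment (V i) (V (mu (i + 1) n)) edge_of P)"

definition side_length :: "nat \<Rightarrow> (nat \<Rightarrow> real^2) \<Rightarrow> nat \<Rightarrow> real" where
  "side_length n V i = dist (V i) (V (mu (i + 1) n))"

text \<open>The line through A and B is tangent to the circle, and the point of contact p lies on
  the side AB itself. The latter excludes, for instance, the excircles of a triangle.\<close>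

definition touches_side_at :: "real^2 \<Rightarrow> real \<Rightarrow> real^2 \<Rightarrow> real^2 \<Rightarrow> real^2 \<Rightarrow> bool" where
  "touches_side_at c r A B p \<longleftrightarrow>
     sphere c r \<inter> affine hull {A, B} = {p} \<and> p \<in> closed_segment A B"

definition incircle :: "nat \<Rightarrow> (nat \<Rightarrow> real^2) \<Rightarrow> real^2 \<Rightarrow> real \<Rightarrow> bool" where
  "incircle n V c r \<longleftrightarrow>
     r > 0 \<and> (\<forall>i\<in>{1..n}. \<exists>p. touches_side_at c r (V i) (V (mu (i + 1) n)) p)"

definition tangential_polygon :: "(real^2) set \<Rightarrow> nat \<Rightarrow> (nat \<Rightarrow> real^2) \<Rightarrow> bool" where
  "tangential_polygon P n V \<longleftrightarrow> convex_polygon P n V \<and> (\<exists>c r. incircle n V c r)"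

text \<open>The common distance from \<open>V i\<close> to the points of contact on the two sides ending at
  \<open>V i\<close>; it is well defined by lemma \<open>tangent_length_eq\<close> below.\<close>

definition tangent_length ::
    "nat \<Rightarrow> (nat \<Rightarrow> real^2) \<Rightarrow> real^2 \<Rightarrow> real \<Rightarrow> nat \<Rightarrow> real" where
  "tangent_length n V c r i =
     (THE t. \<forall>p. touches_side_at c r (V i) (V (mu (i + 1) n)) p \<or>
                 touches_side_at c r (V (mu (i + n - 1) n)) (V i) p \<longrightarrow> dist (V i) p = t)"

definition extension_endpoint :: "real^2 \<Rightarrow> real^2 \<Rightarrow> real \<Rightarrow> real^2" where
  "extension_endpoint U V x = V + (x / norm (V - U)) *\<^sub>R (V - U)"

lemma touches_side_at_commute:
  "touches_side_at c r A B p \<longleftrightarrow> touches_side_at c r B A p"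
  by (simp add: touches_side_at_def insert_commute closed_segment_commute)

lemma touches_side_at_orthogonal:
  assumes "touches_side_at c r A B p"
  shows "(p - c) \<bullet> (B - A) = 0"
proof (cases "A = B")
  case False
  define d where "d = B - A"
  define k where "k = 2 * ((p - c) \<bullet> d) / (d \<bullet> d)"
  have d: "d \<bullet> d \<noteq> 0" using False by (simp add: d_def)
  have S: "sphere c r \<inter> affine hull {A, B} = {p}"
    using assms by (simp add: touches_side_at_def)
  have r: "norm (p - c) = r" using S by (auto simp: dist_norm norm_minus_commute)
  obtain u v where uv: "p = u *\<^sub>R A + v *\<^sub>R B" "u + v = 1"
    using S unfolding affine_hull_2 by blast
  have "p - k *\<^sub>R d = (u + k) *\<^sub>R A + (v - k) *\<^sub>R B"
    by (simp add: uv(1) d_def algebra_simps)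
  then have line: "p - k *\<^sub>R d \<in> affine hull {A, B}"
    using uv(2) unfolding affine_hull_2 by force
  have "(norm (p - k *\<^sub>R d - c))\<^sup>2 = ((p - c) - k *\<^sub>R d) \<bullet> ((p - c) - k *\<^sub>R d)"
    by (simp add: power2_norm_eq_inner algebra_simps)
  also have "\<dots> = (p - c) \<bullet> (p - c) - 2 * k * ((p - c) \<bullet> d) + k * (k * (d \<bullet> d))"
    unfolding inner_diff_left inner_diff_right inner_scaleR_left inner_scaleR_right
    by (simp add: inner_commute algebra_simps)
  also have "k * (d \<bullet> d) = 2 * ((p - c) \<bullet> d)" using d by (simp add: k_def)
  finally have "(norm (p - k *\<^sub>R d - c))\<^sup>2 = (norm (p - c))\<^sup>2"
    by (simp add: power2_norm_eq_inner)
  then have "norm (p - k *\<^sub>R d - c) = r" using r by (metis norm_ge_zero power2_eq_imp_eq)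
  then have "p - k *\<^sub>R d \<in> sphere c r" by (simp add: dist_norm norm_minus_commute)
  then have "p - k *\<^sub>R d = p" using line S by blast
  then have "k = 0" using d by auto
  then show ?thesis using d by (simp add: k_def d_def)
qed simp

lemma touches_side_at_dist:
  assumes "touches_side_at c r A B p"
  shows "dist A p = sqrt ((dist A c)\<^sup>2 - r\<^sup>2)"
proof -
  have "p \<in> closed_segment A B" and "p \<in> sphere c r"
    using assms by (auto simp: touches_side_at_def)
  then obtain u where u: "p = A + u *\<^sub>R (B - A)" and r: "norm (p - c) = r"
    by (auto simp: in_segment algebra_simps dist_norm norm_minus_commute)
  have "(p - c) \<bullet> (p - A) = u * ((p - c) \<bullet> (B - A))" by (simp add: u)
  then have "(p - c) \<bullet> (p - A) = 0" using touches_side_at_orthogonal[OF assms] by simp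
  moreover have "A - c = (p - c) - (p - A)" by simp
  ultimately have "(norm (A - c))\<^sup>2 = (norm (p - c))\<^sup>2 + (norm (p - A))\<^sup>2"
    by (simp add: power2_norm_eq_inner inner_diff_left inner_diff_right inner_commute)
  then show ?thesis
    by (simp add: r dist_norm norm_minus_commute[of p A])
qed

lemma tangent_length_eq:
  assumes "incircle n V c r" "i \<in> {1..n}"
    and "touches_side_at c r (V i) (V (mu (i + 1) n)) p \<or>
         touches_side_at c r (V (mu (i + n - 1) n)) (V i) p"
  shows "tangent_length n V c r i = dist (V i) p"
proof -
  obtain q where "touches_side_at c r (V i) (V (mu (i + 1) n)) q"
    using assms(1,2) unfolding incircle_def by blast
  then have "tangent_length n V c r i = sqrt ((dist (V i) c)\<^sup>2 - r\<^sup>2)"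
    unfolding tangent_length_def
    by (intro the_equality)
      (use touches_side_at_dist touches_side_at_commute in metis)+
  then show ?thesis
    using assms(3) touches_side_at_commute touches_side_at_dist by metis
qed

end

(* By Pythagoras, an endpoint of an extension at V_i has squared distance r^2 + (t_i + x_i)^2
   from the incenter. As t_i + x_i \<ge> 0, the endpoints are concyclic about the incenter iff all
   the numbers t_i + x_i agree. Since the i-th side has length t_i + t_(i+1), the stated equations
   say t_i + x_i = t_(i+2) + x_(i+2), and for odd n steps of size 2 reach every index. *)

theory Submission imports Defs begin

text \<open>Since \<open>i + k\<close> is below \<open>2 * n\<close>, the index wraps at most once.
  This turns later identities between cyclic indices into linear arithmetic.\<close>

lemma mu_add:
  assumes "i \<in> {1..n}" "k < n"
  shows "mu (i + k) n = (if i + k \<le> n then i + k else i + k - n)"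
  using assms by (auto simp: mu_def le_mod_geq)

text \<open>From 1, steps of two run through the odd indices and reach \<open>n\<close>, because
  \<open>n\<close> is odd. The next step wraps from \<open>n\<close> to 2, which joins the even
  indices to the odd ones.\<close>

lemma mu_step_two_const:
  assumes n: "n \<ge> 3" "odd n"
    and step: "\<forall>i\<in>{1..n}. a i = a (mu (i + 2) n)"
    and i: "i \<in> {1..n}"
  shows "a i = a 1"
proof -
  have suc: "a (i + 2) = a i" if "1 \<le> i" "i + 2 \<le> n" for i
    using bspec[OF step, of i] mu_add[of i n 2] that n(1) by simp
  have odd: "a (2 * k + 1) = a 1" if "2 * k + 1 \<le> n" for k
    using that
  proof (induction k)
    case (Suc k)
    then show ?case using suc[of "2 * k + 1"] by simp
  qed simp
  have even: "a (2 * k + 2) = a 2" if "2 * k + 2 \<le> n" for k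
    using that
  proof (induction k)
    case (Suc k)
    then show ?case using suc[of "2 * k + 2"] by (simp add: algebra_simps)
  qed (simp add: numeral_2_eq_2)
  have "mu (n + 2) n = 2" using n mu_add[of n n 2] by simp
  then have "a n = a 2" using step n by auto
  moreover have "a n = a 1" using n(2) odd by (metis oddE order_refl)
  ultimately have a2: "a 2 = a 1" by simp
  show ?thesis
  proof (cases "odd i")
    case True
    then show ?thesis using odd i by (metis oddE atLeastAtMost_iff)
  next
    case False
    then obtain m where "i = 2 * m" by blast
    \<comment> \<open>As \<open>i\<close> is positive, so is \<open>m\<close>, and the subtraction
      on naturals is not truncated.\<close>
    then have "i = 2 * (m - 1) + 2" using i by (cases m) auto
    then show ?thesis using even[of "m - 1"] a2 i by auto
  qed
qed

text \<open>The center, the point of contact and the endpoint span a right angle at the point of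
  contact. Along the side the endpoint has signed coordinate \<open>dist W p + x\<close> from there,
  whatever the sign of \<open>x\<close>.\<close>

lemma dist_extension_endpoint:
  assumes t: "touches_side_at c r U W p" and ne: "U \<noteq> W"
  shows "(dist c (extension_endpoint U W x))\<^sup>2 = r\<^sup>2 + (dist W p + x)\<^sup>2"
proof -
  define d where "d = (1 / norm (W - U)) *\<^sub>R (W - U)"
  have nd: "norm d = 1" using ne by (simp add: d_def)
  have "p \<in> closed_segment U W" and "p \<in> sphere c r"
    using t by (auto simp: touches_side_at_def)
  then obtain u where u: "p = (1 - u) *\<^sub>R U + u *\<^sub>R W" "u \<le> 1" and r: "norm (p - c) = r"
    by (auto simp: in_segment dist_norm norm_minus_commute)
  \<comment> \<open>As \<open>p\<close> lies on the segment, \<open>1 - u\<close> is nonnegative, so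
    \<open>W - p\<close> points along \<open>d\<close> and not against it.\<close>
  have Wp: "W - p = (1 - u) *\<^sub>R (W - U)" by (simp add: u algebra_simps)
  then have "dist W p = (1 - u) * norm (W - U)" using u(2) by (simp add: dist_norm)
  then have "W - p = dist W p *\<^sub>R d" using ne by (simp add: Wp d_def)
  moreover have "extension_endpoint U W x = W + x *\<^sub>R d"
    by (simp add: extension_endpoint_def d_def)
  ultimately have e: "extension_endpoint U W x - c = (p - c) + (dist W p + x) *\<^sub>R d"
    by (simp add: scaleR_add_left algebra_simps flip: \<open>W - p = dist W p *\<^sub>R d\<close>)
  have "orthogonal (p - c) ((dist W p + x) *\<^sub>R d)"
    using touches_side_at_orthogonal[OF t] by (simp add: orthogonal_def d_def)
  from norm_add_Pythagorean[OF this] show ?thesis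
    by (simp add: dist_commute[of c] dist_norm[of _ c] e r nd)
qed

lemma mu_succ_pred:
  assumes "i \<in> {1..n}" "n \<ge> 2"
  shows "mu (i + 1) n \<in> {1..n}" "mu (i + n - 1) n \<in> {1..n}"
    "mu (mu (i + 1) n + n - 1) n = i" "mu (mu (i + n - 1) n + 1) n = i"
proof -
  have pred: "mu (j + n - 1) n = (if j = 1 then n else j - 1)" if "j \<in> {1..n}" for j
    using that assms(2) mu_add[of j n "n - 1"] by auto
  have succ: "mu (j + 1) n = (if j = n then 1 else j + 1)" if "j \<in> {1..n}" for j
    using that assms(2) mu_add[of j n 1] by auto
  show s: "mu (i + 1) n \<in> {1..n}" and p: "mu (i + n - 1) n \<in> {1..n}"
    using assms unfolding succ[OF assms(1)] pred[OF assms(1)] by auto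
  show "mu (mu (i + 1) n + n - 1) n = i"
    using assms unfolding pred[OF s] unfolding succ[OF assms(1)] by auto
  show "mu (mu (i + n - 1) n + 1) n = i"
    using assms unfolding succ[OF p] unfolding pred[OF assms(1)] by auto
qed

lemma mu_succ_succ:
  assumes "i \<in> {1..n}" "n \<ge> 3"
  shows "mu (mu (i + 1) n + 1) n = mu (i + 2) n"
proof -
  have "mu (i + 1) n \<in> {1..n}" using assms by (intro mu_succ_pred) auto
  then show ?thesis
    using assms mu_add[of i n 1] mu_add[of i n 2] mu_add[of "mu (i + 1) n" n 1]
    by (auto split: if_splits)
qed

text \<open>The point of contact lies between the ends of the side and cuts it into the two tangent
  segments.\<close>

lemma side_length_eq_tangent_lengths:
  assumes inc: "incircle n V c r" and "n \<ge> 2" and i: "i \<in> {1..n}"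
  shows "side_length n V i = tangent_length n V c r i + tangent_length n V c r (mu (i + 1) n)"
proof -
  obtain p where p: "touches_side_at c r (V i) (V (mu (i + 1) n)) p"
    using inc i unfolding incircle_def by blast
  have j: "mu (i + 1) n \<in> {1..n}" "mu (mu (i + 1) n + n - 1) n = i"
    using i assms(2) mu_succ_pred by auto
  have "tangent_length n V c r i = dist (V i) p"
    using tangent_length_eq[OF inc i] p by blast
  \<comment> \<open>Seen from the next vertex, the same side is the preceding one, since the
    predecessor of the successor of \<open>i\<close> is \<open>i\<close>.\<close>
  moreover have "tangent_length n V c r (mu (i + 1) n) = dist (V (mu (i + 1) n)) p"
    using tangent_length_eq[OF inc j(1)] p j(2) by metis
  moreover have "between (V i, V (mu (i + 1) n)) p"
    using p by (simp add: between_mem_segment touches_side_at_def)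
  ultimately show ?thesis
    by (simp add: between side_length_def dist_commute)
qed

theorem theorem2:
  fixes P :: "(real^2) set" and V :: "nat \<Rightarrow> real^2" and n :: nat
    and c :: "real^2" and r :: real and x :: "nat \<Rightarrow> real"
  assumes "n \<ge> 3" and "odd n"
    and "tangential_polygon P n V"
    and "incircle n V c r"
    and "\<forall>i\<in>{1..n}. x i \<ge> - tangent_length n V c r i"
  shows "(\<exists>R>0. \<forall>i\<in>{1..n}.
            extension_endpoint (V (mu (i + n - 1) n)) (V i) (x i) \<in> sphere c R \<and>
            extension_endpoint (V (mu (i + 1) n)) (V i) (x i) \<in> sphere c R)
         \<longleftrightarrow>
         (\<forall>i\<in>{1..n}. x i - x (mu (i + 2) n) =
            side_length n V (mu (i + 1) n) - side_length n V i)"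
proof -
  define a where "a i = tangent_length n V c r i + x i" for i
  have a0: "a i \<ge> 0" if "i \<in> {1..n}" for i
    using bspec[OF assms(5) that] by (simp add: a_def)
  have r: "r > 0" using assms(4) by (simp add: incircle_def)
  have inj: "inj_on V {1..n}"
    using assms(3) by (auto simp: tangential_polygon_def convex_polygon_def bij_betw_def)
  \<comment> \<open>Neighbouring vertices must differ for the direction in
    \<open>extension_endpoint\<close> to be a unit vector, as it divides by their distance.\<close>
  have adj: "V i \<noteq> V (mu (i + 1) n)" if i: "i \<in> {1..n}" for i
  proof -
    have "mu (i + 1) n \<noteq> i" using i assms(1) mu_add[of i n 1] by auto
    moreover have "mu (i + 1) n \<in> {1..n}" using i assms(1) by (intro mu_succ_pred) auto
    ultimately show ?thesis using inj i by (metis inj_onD)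
  qed
  have succ: "(dist c (extension_endpoint (V (mu (i + 1) n)) (V i) (x i)))\<^sup>2 = r\<^sup>2 + (a i)\<^sup>2"
    if i: "i \<in> {1..n}" for i
  proof -
    obtain p where p: "touches_side_at c r (V i) (V (mu (i + 1) n)) p"
      using assms(4) i unfolding incircle_def by blast
    have "tangent_length n V c r i = dist (V i) p"
      using tangent_length_eq[OF assms(4) i] p by blast
    \<comment> \<open>This extension runs from the successor towards \<open>V i\<close>, so the ends
      of the side are swapped.\<close>
    with p adj[OF i] show ?thesis
      by (simp add: a_def dist_extension_endpoint touches_side_at_commute)
  qed
  have pred: "(dist c (extension_endpoint (V (mu (i + n - 1) n)) (V i) (x i)))\<^sup>2 = r\<^sup>2 + (a i)\<^sup>2"
    if i: "i \<in> {1..n}" for i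
  proof -
    have j: "mu (i + n - 1) n \<in> {1..n}" "mu (mu (i + n - 1) n + 1) n = i"
      using i assms(1) mu_succ_pred by auto
    then obtain p where p: "touches_side_at c r (V (mu (i + n - 1) n)) (V i) p"
      using assms(4) unfolding incircle_def by metis
    have "tangent_length n V c r i = dist (V i) p"
      using tangent_length_eq[OF assms(4) i] p by blast
    with adj[OF j(1)] j(2) show ?thesis
      using dist_extension_endpoint[OF p] by (simp add: a_def)
  qed
  \<comment> \<open>In the difference of consecutive side lengths the tangent length at their common
    vertex cancels.\<close>
  have eqs: "x i - x (mu (i + 2) n) = side_length n V (mu (i + 1) n) - side_length n V i
      \<longleftrightarrow> a i = a (mu (i + 2) n)" if i: "i \<in> {1..n}" for i
  proof -
    have "mu (i + 1) n \<in> {1..n}" using i assms(1) by (intro mu_succ_pred) auto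
    then show ?thesis
      using side_length_eq_tangent_lengths[OF assms(4)] i mu_succ_succ[OF i] assms(1)
      by (auto simp: a_def)
  qed
  show ?thesis
  proof
    assume "\<exists>R>0. \<forall>i\<in>{1..n}.
            extension_endpoint (V (mu (i + n - 1) n)) (V i) (x i) \<in> sphere c R \<and>
            extension_endpoint (V (mu (i + 1) n)) (V i) (x i) \<in> sphere c R"
    then obtain R where R: "\<And>i. i \<in> {1..n} \<Longrightarrow> R\<^sup>2 = r\<^sup>2 + (a i)\<^sup>2"
      using succ by (metis mem_sphere)
    \<comment> \<open>The squares agree, and nonnegativity of \<open>a\<close> rules out opposite
      signs.\<close>
    have eq: "a i = a j" if "i \<in> {1..n}" "j \<in> {1..n}" for i j
      using R[OF that(1)] R[OF that(2)] a0 that by (simp add: power2_eq_iff_nonneg)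
    have "mu (i + 2) n \<in> {1..n}" if "i \<in> {1..n}" for i
      using that assms(1) mu_add[of i n 2] by auto
    then show "\<forall>i\<in>{1..n}. x i - x (mu (i + 2) n) =
            side_length n V (mu (i + 1) n) - side_length n V i"
      using eqs eq by blast
  next
    assume "\<forall>i\<in>{1..n}. x i - x (mu (i + 2) n) =
            side_length n V (mu (i + 1) n) - side_length n V i"
    then have const: "a i = a 1" if "i \<in> {1..n}" for i
      using mu_step_two_const[of n a i] eqs assms(1,2) that by blast
    \<comment> \<open>Pythagoras dictates this radius; \<open>r > 0\<close> keeps it positive even
      if all \<open>a i\<close> vanish.\<close>
    define R where "R = sqrt (r\<^sup>2 + (a 1)\<^sup>2)"
    have "R > 0" using r by (simp add: R_def add_pos_nonneg)
    moreover have "e \<in> sphere c R" if "(dist c e)\<^sup>2 = r\<^sup>2 + (a 1)\<^sup>2" for e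
      using real_sqrt_unique[OF that] by (simp add: R_def)
    ultimately show "\<exists>R>0. \<forall>i\<in>{1..n}.
            extension_endpoint (V (mu (i + n - 1) n)) (V i) (x i) \<in> sphere c R \<and>
            extension_endpoint (V (mu (i + 1) n)) (V i) (x i) \<in> sphere c R"
      using succ pred const by metis
  qed
qed

end
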